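(* Let $T>0$, $I=[0,T]$, let $\alpha,\beta:I\to(0,1]$ be continuous (time-varying memory exponents) and let $x\in\mathcal{C}^1(I)$. For every $t\in(0,T]$, $$\mathscr{V}_{\alpha,\beta}[x](t)=\frac{(\beta(t)+1)\,\Gamma(\beta(t))}{t^{\beta(t)+1}\,\Gamma(\alpha(t))}\int_0^t (t-\tau)^{\alpha(t)-1}\bigl[x(t)-x(\tau)\bigr]\,d\tau.$$
   Context: $\mathcal{C}^1(I)$ is the space of continuously differentiable real-valued functions on $I=[0,T]$ (one-sided derivatives at the endpoints). A time-varying memory exponent is a continuous function $\varrho:I\to\mathbb{R}$ with $\varrho(t)\in(0,1]$ for all $t\in I$. Its memory kernel is $K_\varrho(t,\tau)=\frac{(t-\tau)^{\varrho(t)-1}}{\Gamma(\varrho(t))}$ for $0\le\tau<t\le T$, and $K_\varrho(t,\tau)=0$ for $\tau\ge t$, where $\Gamma$ is the Gamma function. For memory exponents $\alpha,\beta$ and $x\in\mathcal{C}^1(I)$, the memory-weighted velocity operator is the function $\mathscr{V}_{\alpha,\beta}[x]:I\to\mathbb{R}$ given by $$\mathscr{V}_{\alpha,\beta}[x](t)=\frac{\int_0^t K_\alpha(t,\tau)\,[x(t)-x(\tau)]\,d\tau}{\int_0^t K_\beta(t,\tau)\,(t-\tau)\,d\tau}\quad (t\in(0,T]),\qquad \mathscr{V}_{\alpha,\beta}[x](0)=\dot{x}(0).$$ *)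

theory Defs
  imports "HOL-Analysis.Analysis"
begin

text \<open>
  Functions on \<open>I = [0,T]\<close> are represented by total functions \<open>real \<Rightarrow> real\<close>; only their values
  on \<open>{0..T}\<close> are constrained or used.
\<close>

text \<open>
  The derivative is taken within \<open>{0..T}\<close>, hence one-sided at the endpoints; the library predicate
  \<open>C1_differentiable_on\<close> would instead demand two-sided derivatives there.
\<close>
definition C1_on_interval :: "real \<Rightarrow> (real \<Rightarrow> real) \<Rightarrow> bool" where
  "C1_on_interval T x \<longleftrightarrow>
     (\<exists>x'. continuous_on {0..T} x' \<and>
           (\<forall>t\<in>{0..T}. (x has_real_derivative x' t) (at t within {0..T})))"

definition memory_exponent :: "real \<Rightarrow> (real \<Rightarrow> real) \<Rightarrow> bool" where
  "memory_exponent T \<rho> \<longleftrightarrow> continuous_on {0..T} \<rho> \<and> (\<forall>t\<in>{0..T}. 0 < \<rho> t \<and> \<rho> t \<le> 1)"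

definition memory_kernel :: "(real \<Rightarrow> real) \<Rightarrow> real \<Rightarrow> real \<Rightarrow> real" where
  "memory_kernel \<rho> t \<tau> = (if \<tau> < t then (t - \<tau>) powr (\<rho> t - 1) / Gamma (\<rho> t) else 0)"

text \<open>Meaningful for \<open>t \<in> {0..T}\<close>; \<open>T\<close> enters only through the one-sided derivative at \<open>0\<close>.\<close>
definition memory_velocity ::
  "real \<Rightarrow> (real \<Rightarrow> real) \<Rightarrow> (real \<Rightarrow> real) \<Rightarrow> (real \<Rightarrow> real) \<Rightarrow> real \<Rightarrow> real" where
  "memory_velocity T \<alpha> \<beta> x t =
     (if t = 0 then vector_derivative x (at 0 within {0..T})
      else integral {0..t} (\<lambda>\<tau>. memory_kernel \<alpha> t \<tau> * (x t - x \<tau>)) /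
           integral {0..t} (\<lambda>\<tau>. memory_kernel \<beta> t \<tau> * (t - \<tau>)))"

end

theory Submission
  imports Defs
begin

text \<open>For fixed t the exponent and the Gamma factor of the kernel are constants in \<tau>, so
  1/Gamma leaves both integrals (\<open>integral_memory_kernel_mult\<close>). In the denominator the
  extra factor t - \<tau> raises the power to \<beta>(t), and the elementary power integral gives a
  closed form (\<open>integral_memory_kernel_velocity\<close>). Dividing by it yields the
  prefactor.\<close>

lemma memory_kernel_mult_eq:
  fixes \<rho> x :: "real \<Rightarrow> real"
  assumes "\<tau> \<le> t"
  shows "memory_kernel \<rho> t \<tau> * (x t - x \<tau>) =
    inverse (Gamma (\<rho> t)) * ((t - \<tau>) powr (\<rho> t - 1) * (x t - x \<tau>))"
  \<comment> \<open>On the diagonal the increment \<open>x t - x \<tau>\<close> vanishes, so the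
    kernel's cutoff value 0 does no harm.\<close>
  using assms by (cases "\<tau> = t") (auto simp: memory_kernel_def field_simps)

text \<open>A scalar passes through \<open>integral\<close> even for a non-integrable integrand,
  where the default value 0 makes both sides 0.\<close>

lemma integral_memory_kernel_mult:
  fixes \<rho> x :: "real \<Rightarrow> real"
  shows "integral {0..t} (\<lambda>\<tau>. memory_kernel \<rho> t \<tau> * (x t - x \<tau>)) =
    inverse (Gamma (\<rho> t)) * integral {0..t} (\<lambda>\<tau>. (t - \<tau>) powr (\<rho> t - 1) * (x t - x \<tau>))"
proof -
  have "integral {0..t} (\<lambda>\<tau>. memory_kernel \<rho> t \<tau> * (x t - x \<tau>)) =
    integral {0..t} (\<lambda>\<tau>. inverse (Gamma (\<rho> t)) * ((t - \<tau>) powr (\<rho> t - 1) * (x t - x \<tau>)))"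
    by (intro integral_cong memory_kernel_mult_eq) auto
  then show ?thesis by simp
qed

text \<open>For a < 0 the integrand is singular at \<tau> = t; the antiderivative stays continuous
  there because a + 1 > 0, so differentiating it in the interior suffices.\<close>

lemma has_integral_powr_reflected:
  fixes a t :: real
  assumes "a > -1" "t \<ge> 0"
  shows "((\<lambda>\<tau>. (t - \<tau>) powr a) has_integral t powr (a + 1) / (a + 1)) {0..t}"
proof -
  define F where "F = (\<lambda>\<tau>. - ((t - \<tau>) powr (a + 1) / (a + 1)))"
  have "((\<lambda>\<tau>. (t - \<tau>) powr a) has_integral F t - F 0) {0..t}"
  proof (rule fundamental_theorem_of_calculus_interior)
    show "continuous_on {0..t} F"
      unfolding F_def using assms
      by (intro continuous_intros continuous_on_powr') auto
    show "(F has_vector_derivative (t - \<tau>) powr a) (at \<tau>)" if "\<tau> \<in> {0<..<t}" for \<tau>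
      unfolding F_def has_real_derivative_iff_has_vector_derivative[symmetric]
      using that assms by (auto intro!: derivative_eq_intros)
  qed (use assms in auto)
  then show ?thesis using assms by (simp add: F_def)
qed

lemma integral_memory_kernel_velocity:
  assumes "\<rho> t > 0" "t \<ge> 0"
  shows "integral {0..t} (\<lambda>\<tau>. memory_kernel \<rho> t \<tau> * (t - \<tau>)) =
    t powr (\<rho> t + 1) / ((\<rho> t + 1) * Gamma (\<rho> t))"
proof -
  have "integral {0..t} (\<lambda>\<tau>. (t - \<tau>) powr (\<rho> t - 1) * (t - \<tau>)) =
      integral {0..t} (\<lambda>\<tau>. (t - \<tau>) powr \<rho> t)"
    \<comment> \<open>At \<tau> = t both integrands are 0, as \<open>0 powr \<rho> t\<close> is
      0.\<close>
    by (intro integral_cong) (auto simp: powr_diff)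
  also have "\<dots> = t powr (\<rho> t + 1) / (\<rho> t + 1)"
    using assms by (intro integral_unique has_integral_powr_reflected) auto
  finally show ?thesis
    \<comment> \<open>With the identity as x, the increment is exactly t - \<tau>.\<close>
    using integral_memory_kernel_mult[of t \<rho> "\<lambda>\<tau>. \<tau>"] by (simp add: field_simps)
qed

theorem corollary2p1:
  fixes T :: real and \<alpha> \<beta> x :: "real \<Rightarrow> real"
  assumes "T > 0"
    and "memory_exponent T \<alpha>"
    and "memory_exponent T \<beta>"
    and "C1_on_interval T x"
  shows "\<forall>t\<in>{0<..T}.
    memory_velocity T \<alpha> \<beta> x t =
      ((\<beta> t + 1) * Gamma (\<beta> t)) / (t powr (\<beta> t + 1) * Gamma (\<alpha> t)) *
      integral {0..t} (\<lambda>\<tau>. (t - \<tau>) powr (\<alpha> t - 1) * (x t - x \<tau>))"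
proof
  fix t assume t: "t \<in> {0<..T}"
  then have "\<beta> t > 0"
    using assms(3) by (auto simp: memory_exponent_def)
  \<comment> \<open>Since t > 0, the quotient branch of \<open>memory_velocity\<close> applies, and
    \<beta>(t) > 0 gives its denominator in closed form.\<close>
  with t show "memory_velocity T \<alpha> \<beta> x t =
      ((\<beta> t + 1) * Gamma (\<beta> t)) / (t powr (\<beta> t + 1) * Gamma (\<alpha> t)) *
      integral {0..t} (\<lambda>\<tau>. (t - \<tau>) powr (\<alpha> t - 1) * (x t - x \<tau>))"
    by (simp add: memory_velocity_def integral_memory_kernel_mult
        integral_memory_kernel_velocity divide_inverse)
qed

end
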